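(* Let $1\le k\le n-1$. For every real $\lambda$, the constant $\sqrt{n\lambda^2-2k\lambda+k}$ in the inequality $$\sum_{i=1}^{n}B_iH_i\le\sqrt{n\lambda^{2}-2k\lambda+k}\;SP,$$ which holds for all simplices $SA_1\ldots A_n$ in $\mathbb R^n$ right at $S$ and all $k$-dimensional linear subspaces $L$ of $\mathbb R^n$, is best possible (it cannot be replaced by a smaller constant). More precisely, fix an orthonormal system $\mathbf e_1,\ldots,\mathbf e_n$ of edge directions in $\mathbb R^n$ and a $k$-dimensional linear subspace $L$, and consider the right simplices with $\overrightarrow{SA_i}=a_i\mathbf e_i$, $a_i>0$. (a) If $\lambda\ne0$ and $\lambda\neq1$, then for every position of $L$ one can choose positive edge lengths $a_1,\ldots,a_n$ so that equality holds. (b) If $\lambda=0$, equality is attainable for the given $L$ by some choice of positive edge lengths if and only if no edge direction $\mathbf e_i$ is orthogonal to $L$. (c) If $\lambda=1$, equality is attainable for the given $L$ by some choice of positive edge lengths if and only if no edge direction $\mathbf e_i$ lies in $L$.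
   Context: $SA_1\ldots A_n$ is a simplex in Euclidean space $\mathbb R^n$, with $S$ identified with the origin. It is right at $S$ if $SA_i\perp SA_j$ for all $i\neq j$; then $P$ is the vertex opposite $S$ of the orthotope spanned by the edges at $S$, so $SP^2=\sum_{i=1}^n SA_i^2$. $H_i$ is the orthogonal projection of $A_i$ onto $L$, and $B_i$ is the point with $\overrightarrow{SB_i}=\lambda\overrightarrow{SA_i}$. For points $X,Y$, $XY$ denotes their Euclidean distance. *)

theory Defs
  imports "HOL-Analysis.Analysis"
begin

text \<open>The vertex \<open>S\<close> is the origin of \<open>real ^ 'n\<close>, so that \<open>n = CARD('n)\<close>, and the other
  vertices form a family \<open>A :: 'n \<Rightarrow> real ^ 'n\<close>. Injectivity and \<open>0 \<notin> range A\<close> are needed because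
  \<open>affine_dependent\<close> speaks about the set of vertices and does not notice repetitions.\<close>

definition simplex_at_0 :: "('n::finite \<Rightarrow> real ^ 'n) \<Rightarrow> bool" where
  "simplex_at_0 A \<longleftrightarrow>
     inj A \<and> 0 \<notin> range A \<and> \<not> affine_dependent (insert 0 (range A))"

definition right_simplex_at_0 :: "('n::finite \<Rightarrow> real ^ 'n) \<Rightarrow> bool" where
  "right_simplex_at_0 A \<longleftrightarrow>
     simplex_at_0 A \<and> (\<forall>i j. i \<noteq> j \<longrightarrow> orthogonal (A i) (A j))"

text \<open>The orthotope spanned by the edges at \<open>0\<close> is \<open>{\<Sum>i. t i *\<^sub>R A i | t. \<forall>i. 0 \<le> t i \<le> 1}\<close>; its vertex
  opposite \<open>0\<close> is the one with all \<open>t i = 1\<close>.\<close>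

definition opposite_vertex :: "('n::finite \<Rightarrow> real ^ 'n) \<Rightarrow> real ^ 'n" where
  "opposite_vertex A = (\<Sum>i\<in>UNIV. A i)"

definition orth_proj :: "('a::euclidean_space) set \<Rightarrow> 'a \<Rightarrow> 'a" where
  "orth_proj L x = (THE h. h \<in> L \<and> (\<forall>y\<in>L. orthogonal (x - h) y))"

text \<open>\<open>B\<^sub>i = l *\<^sub>R A i\<close> and \<open>H\<^sub>i = orth_proj L (A i)\<close>.\<close>

definition sum_BH :: "real \<Rightarrow> ('n::finite \<Rightarrow> real ^ 'n) \<Rightarrow> (real ^ 'n) set \<Rightarrow> real" where
  "sum_BH l A L = (\<Sum>i\<in>UNIV. dist (l *\<^sub>R A i) (orth_proj L (A i)))"

definition orthonormal_system :: "('n::finite \<Rightarrow> real ^ 'n) \<Rightarrow> bool" where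
  "orthonormal_system e \<longleftrightarrow>
     (\<forall>i. norm (e i) = 1) \<and> (\<forall>i j. i \<noteq> j \<longrightarrow> orthogonal (e i) (e j))"

definition bound_const :: "nat \<Rightarrow> nat \<Rightarrow> real \<Rightarrow> real" where
  "bound_const n k l = sqrt (real n * l\<^sup>2 - 2 * real k * l + real k)"

definition bound_holds :: "'n::finite itself \<Rightarrow> nat \<Rightarrow> real \<Rightarrow> real \<Rightarrow> bool" where
  "bound_holds _ k l c \<longleftrightarrow>
     (\<forall>(A :: 'n \<Rightarrow> real ^ 'n) L.
        right_simplex_at_0 A \<and> subspace L \<and> dim L = k \<longrightarrow>
        sum_BH l A L \<le> c * dist 0 (opposite_vertex A))"

definition equality_attainable ::
    "nat \<Rightarrow> real \<Rightarrow> ('n::finite \<Rightarrow> real ^ 'n) \<Rightarrow> (real ^ 'n) set \<Rightarrow> bool" where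
  "equality_attainable k l e L \<longleftrightarrow>
     (\<exists>a :: 'n \<Rightarrow> real. (\<forall>i. 0 < a i) \<and>
        sum_BH l (\<lambda>i. a i *\<^sub>R e i) L =
          bound_const CARD('n) k l * dist 0 (opposite_vertex (\<lambda>i. a i *\<^sub>R e i)))"

text \<open>The description in \<open>orth_proj\<close> is proper, and the scaled orthonormal systems in
  \<open>equality_attainable\<close> are indeed right simplices.\<close>

lemma orth_proj:
  fixes L :: "('a::euclidean_space) set"
  assumes "subspace L"
  shows "orth_proj L x \<in> L \<and> (\<forall>y\<in>L. orthogonal (x - orth_proj L x) y)"
proof -
  obtain y z where yz: "y \<in> span L" "\<And>w. w \<in> span L \<Longrightarrow> orthogonal z w" "x = y + z"
    using orthogonal_subspace_decomp_exists[of L x] by metis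
  have sp: "span L = L" using assms by (simp add: span_eq_iff)
  show ?thesis
    unfolding orth_proj_def
  proof (rule theI)
    show "y \<in> L \<and> (\<forall>w\<in>L. orthogonal (x - y) w)" using yz sp by auto
  next
    fix h assume h: "h \<in> L \<and> (\<forall>w\<in>L. orthogonal (x - h) w)"
    have d: "h - y \<in> L" using h yz sp assms by (auto intro: subspace_diff)
    have "(x - h) \<bullet> (h - y) = 0" "(x - y) \<bullet> (h - y) = 0"
      using h yz d sp by (auto simp: orthogonal_def)
    then have "(h - y) \<bullet> (h - y) = 0" by (simp add: inner_diff_left)
    then show "h = y" by simp
  qed
qed

lemma right_simplex_scaled:
  assumes e: "orthonormal_system e" and a: "\<And>i. 0 < a i"
  shows "right_simplex_at_0 (\<lambda>i. a i *\<^sub>R e i)"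
proof -
  let ?A = "\<lambda>i. a i *\<^sub>R e i"
  have nz: "?A i \<noteq> 0" for i
    using e a[of i] by (metis norm_zero orthonormal_system_def scaleR_eq_0_iff zero_neq_one less_irrefl)
  have orth: "orthogonal (?A i) (?A j)" if "i \<noteq> j" for i j
    using e that by (auto simp: orthonormal_system_def orthogonal_def)
  have inj: "inj ?A"
    using nz orth by (metis (mono_tags, lifting) injI orthogonal_self)
  have "pairwise orthogonal (range ?A)"
    unfolding pairwise_def using orth by (metis (no_types, lifting) rangeE)
  moreover have z: "0 \<notin> range ?A" using nz by force
  ultimately have "independent (range ?A)"
    by (rule pairwise_orthogonal_independent)
  then have "\<not> affine_dependent (insert 0 (range ?A))"
    using z by (simp add: affine_dependent_iff_dependent)
  then show ?thesis
    using inj z orth by (simp add: right_simplex_at_0_def simplex_at_0_def)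
qed

end

theory Submission
  imports Defs
begin

text \<open>
  Let \<open>P\<close> be the orthogonal projection onto \<open>L\<close>, write \<open>a i *\<^sub>R e i\<close> for the edges, with \<open>e\<close>
  orthonormal and \<open>a i > 0\<close>, and put \<open>d i = \<bar>l *\<^sub>R e i - P (e i)\<bar>\<close>. As \<open>P\<close> is homogeneous, the left-hand
  side of the inequality is \<open>\<Sum>i. a i * d i\<close>, and the diagonal has length \<open>sqrt (\<Sum>i. (a i)\<^sup>2)\<close>, so
  everything is a question about Cauchy's inequality for the two vectors \<open>a\<close> and \<open>d\<close> of \<open>\<real>\<^sup>n\<close>.

  The constant is the length of \<open>d\<close>: splitting \<open>l *\<^sub>R e i - P (e i)\<close> into its components along \<open>L\<close> and
  across \<open>L\<close> gives \<open>(d i)\<^sup>2 = l\<^sup>2 + (1 - 2 * l) * \<bar>P (e i)\<bar>\<^sup>2\<close>, and the numbers \<open>\<bar>P (e i)\<bar>\<^sup>2\<close> add up to the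
  trace of \<open>P\<close>, which is \<open>k\<close> (\<open>sum_norm_orth_proj\<close>). It is positive because \<open>0 < k < n\<close>. Hence equality
  means that \<open>a\<close> is a positive multiple of \<open>d\<close>, which for a positive vector \<open>a\<close> is possible
  exactly when no \<open>d i\<close> vanishes (\<open>equality_attainable_iff\<close>). The two components of
  \<open>l *\<^sub>R e i - P (e i)\<close> are \<open>(l - 1) *\<^sub>R P (e i)\<close> and \<open>l *\<^sub>R (e i - P (e i))\<close>. They cannot both vanish if
  \<open>l\<close> is neither \<open>0\<close> nor \<open>1\<close>, both vanish for \<open>l = 0\<close> iff \<open>e i\<close> is orthogonal to \<open>L\<close>, and for \<open>l = 1\<close>
  iff \<open>e i\<close> lies in \<open>L\<close>.

  Optimality can be seen on any single \<open>L\<close>, even if some \<open>d i\<close> vanish and equality is out of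
  reach: the edge lengths \<open>a i = d i + t\<close> are positive for \<open>t > 0\<close>, and the ratio of the left-hand
  side to the diagonal tends to the length of \<open>d\<close> as \<open>t\<close> tends to \<open>0\<close> (\<open>bound_const_le\<close>).
\<close>

section \<open>Orthogonal projections\<close>

lemma orth_proj_eqI:
  fixes L :: "('a::euclidean_space) set"
  assumes "subspace L" and "h \<in> L" and "\<And>y. y \<in> L \<Longrightarrow> orthogonal (x - h) y"
  shows "orth_proj L x = h"
proof -
  let ?p = "orth_proj L x"
  have p: "?p \<in> L" "\<And>y. y \<in> L \<Longrightarrow> orthogonal (x - ?p) y"
    using orth_proj[OF assms(1)] by auto
  have "?p - h \<in> L"
    using assms p by (auto intro: subspace_diff)
  then have "(x - h) \<bullet> (?p - h) = 0" "(x - ?p) \<bullet> (?p - h) = 0"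
    using assms(3) p(2) by (auto simp: orthogonal_def)
  then have "(?p - h) \<bullet> (?p - h) = 0"
    by (simp add: inner_diff_left)
  then show ?thesis by simp
qed

lemma orth_proj_scaleR:
  fixes L :: "('a::euclidean_space) set"
  assumes "subspace L"
  shows "orth_proj L (c *\<^sub>R x) = c *\<^sub>R orth_proj L x"
proof (rule orth_proj_eqI[OF assms])
  show "c *\<^sub>R orth_proj L x \<in> L"
    using orth_proj[OF assms] assms by (auto intro: subspace_mul)
  show "orthogonal (c *\<^sub>R x - c *\<^sub>R orth_proj L x) y" if "y \<in> L" for y
    using orth_proj[OF assms, of x] that
    by (auto simp: orthogonal_def simp flip: scaleR_diff_right)
qed

lemma orth_proj_eq_0_iff:
  fixes L :: "('a::euclidean_space) set"
  assumes "subspace L"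
  shows "orth_proj L x = 0 \<longleftrightarrow> (\<forall>y\<in>L. orthogonal x y)"
  using orth_proj[OF assms, of x] orth_proj_eqI[OF assms, of 0 x] subspace_0[OF assms] by auto

lemma orth_proj_eq_self_iff:
  fixes L :: "('a::euclidean_space) set"
  assumes "subspace L"
  shows "orth_proj L x = x \<longleftrightarrow> x \<in> L"
  using orth_proj[OF assms, of x] orth_proj_eqI[OF assms, of x x] by (auto simp: orthogonal_def)

text \<open>Pythagoras for the decomposition of \<open>l *\<^sub>R x - P x\<close> along and across \<open>L\<close>.\<close>

lemma dist_scaleR_orth_proj_sq:
  fixes L :: "('a::euclidean_space) set"
  assumes "subspace L"
  shows "(dist (l *\<^sub>R x) (orth_proj L x))\<^sup>2 =
    ((l - 1) * norm (orth_proj L x))\<^sup>2 + (l * norm (x - orth_proj L x))\<^sup>2"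
proof -
  let ?p = "orth_proj L x"
  have "l *\<^sub>R x - ?p = (l - 1) *\<^sub>R ?p + l *\<^sub>R (x - ?p)"
    by (simp add: algebra_simps)
  moreover have "orthogonal ((l - 1) *\<^sub>R ?p) (l *\<^sub>R (x - ?p))"
    using orth_proj[OF assms, of x] by (auto simp: orthogonal_def inner_commute)
  ultimately show ?thesis
    by (simp add: dist_norm norm_add_Pythagorean power_mult_distrib)
qed

text \<open>The same square in terms of the length of the projection alone, which is the form that can
  be summed.\<close>

lemma dist_scaleR_orth_proj_sq':
  fixes L :: "('a::euclidean_space) set"
  assumes "subspace L"
  shows "(dist (l *\<^sub>R x) (orth_proj L x))\<^sup>2 =
    l\<^sup>2 * (norm x)\<^sup>2 + (1 - 2 * l) * (norm (orth_proj L x))\<^sup>2"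
proof -
  have across: "(norm (x - orth_proj L x))\<^sup>2 = (norm x)\<^sup>2 - (norm (orth_proj L x))\<^sup>2"
    using norm_add_Pythagorean[of "orth_proj L x" "x - orth_proj L x"] orth_proj[OF assms, of x]
    by (auto simp: orthogonal_commute)
  show ?thesis
    unfolding dist_scaleR_orth_proj_sq[OF assms] power_mult_distrib across
    by algebra
qed

text \<open>Parseval's identity on \<open>L\<close>: the projection has the coefficients of \<open>x\<close> itself with respect to
  an orthonormal basis of \<open>L\<close>.\<close>

lemma norm_orth_proj_sq:
  fixes L :: "('a::euclidean_space) set"
  assumes "subspace L" and "finite B" and "span B = L"
    and "pairwise orthogonal B" and "\<And>b. b \<in> B \<Longrightarrow> norm b = 1"
  shows "(norm (orth_proj L x))\<^sup>2 = (\<Sum>b\<in>B. (x \<bullet> b)\<^sup>2)"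
proof -
  let ?p = "orth_proj L x"
  have p: "?p \<in> L" "\<And>y. y \<in> L \<Longrightarrow> ?p \<bullet> y = x \<bullet> y"
    using orth_proj[OF assms(1), of x] by (auto simp: orthogonal_def inner_diff_left)
  have ex: "(\<Sum>b\<in>B. (?p \<bullet> b) *\<^sub>R b) = ?p"
    using assms p by (intro orthonormal_basis_expand) auto
  have "(norm ?p)\<^sup>2 = x \<bullet> (\<Sum>b\<in>B. (?p \<bullet> b) *\<^sub>R b)"
    unfolding ex using p by (simp add: power2_norm_eq_inner)
  also have "\<dots> = (\<Sum>b\<in>B. (x \<bullet> b)\<^sup>2)"
    using p assms(3) by (auto simp: inner_sum_right power2_eq_square span_base intro!: sum.cong)
  finally show ?thesis .
qed

section \<open>Orthonormal systems of edge directions\<close>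

text \<open>Parseval's identity on the whole space: \<open>n\<close> orthonormal vectors are independent, so they span \<open>\<real>\<^sup>n\<close>.\<close>

lemma orthonormal_system_parseval:
  fixes e :: "'n::finite \<Rightarrow> real ^ 'n"
  assumes "orthonormal_system e"
  shows "(\<Sum>i\<in>UNIV. (x \<bullet> e i)\<^sup>2) = (norm x)\<^sup>2"
proof -
  have nrm: "norm (e i) = 1" for i
    using assms by (simp add: orthonormal_system_def)
  have orth: "orthogonal (e i) (e j)" if "i \<noteq> j" for i j
    using assms that by (simp add: orthonormal_system_def)
  have inj: "inj e"
    by (metis injI nrm norm_zero orth orthogonal_self zero_neq_one)
  have pw: "pairwise orthogonal (range e)"
    unfolding pairwise_def using orth by (metis rangeE)
  have "0 \<notin> range e"
    using nrm by (metis norm_zero rangeE zero_neq_one)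
  then have "independent (range e)"
    using pw pairwise_orthogonal_independent by blast
  moreover have "card (range e) = dim (UNIV :: (real ^ 'n) set)"
    using inj by (simp add: card_image)
  ultimately have sp: "span (range e) = UNIV"
    by (metis card_eq_dim subset_UNIV finite finite_imageI top.extremum_unique)
  have ex: "(\<Sum>b\<in>range e. (x \<bullet> b) *\<^sub>R b) = x"
    using pw sp nrm by (intro orthonormal_basis_expand) auto
  have "(norm x)\<^sup>2 = x \<bullet> (\<Sum>b\<in>range e. (x \<bullet> b) *\<^sub>R b)"
    by (simp add: ex power2_norm_eq_inner)
  also have "\<dots> = (\<Sum>i\<in>UNIV. (x \<bullet> e i)\<^sup>2)"
    by (simp add: sum.reindex[OF inj] inner_sum_right power2_eq_square)
  finally show ?thesis by simp
qed

text \<open>The trace of a projection is its rank: with an orthonormal basis \<open>B\<close> of \<open>L\<close>, the double sum of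
  \<open>(e i \<bullet> b)\<^sup>2\<close> is the left-hand side when summed over \<open>b\<close> first, and \<open>card B\<close> when summed over \<open>i\<close>
  first.\<close>

lemma sum_norm_orth_proj:
  fixes e :: "'n::finite \<Rightarrow> real ^ 'n"
  assumes e: "orthonormal_system e" and L: "subspace L"
  shows "(\<Sum>i\<in>UNIV. (norm (orth_proj L (e i)))\<^sup>2) = real (dim L)"
proof -
  obtain B where B: "pairwise orthogonal B" "\<And>b. b \<in> B \<Longrightarrow> norm b = 1"
      "independent B" "card B = dim L" "span B = L"
    using orthonormal_basis_subspace[OF L] by metis
  have fin: "finite B"
    using B(3) by (rule independent_imp_finite)
  have "(\<Sum>i\<in>UNIV. (norm (orth_proj L (e i)))\<^sup>2) = (\<Sum>i\<in>UNIV. \<Sum>b\<in>B. (e i \<bullet> b)\<^sup>2)"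
    using norm_orth_proj_sq[OF L fin B(5) B(1,2)] by simp
  also have "\<dots> = (\<Sum>b\<in>B. \<Sum>i\<in>UNIV. (b \<bullet> e i)\<^sup>2)"
    by (subst sum.swap) (simp add: inner_commute)
  also have "\<dots> = real (dim L)"
    using B(2,4) by (simp add: orthonormal_system_parseval[OF e])
  finally show ?thesis .
qed

text \<open>The discriminant of the quadratic polynomial in \<open>l\<close> is \<open>4 * k * (k - n) < 0\<close>; completing the
  square makes this visible.\<close>

lemma bound_const_pos:
  assumes "0 < k" and "k < n"
  shows "0 < bound_const n k l"
proof -
  have "real n * (real n * l\<^sup>2 - 2 * real k * l + real k)
      = (real n * l - real k)\<^sup>2 + real k * (real n - real k)"
    by (simp add: power2_eq_square algebra_simps)
  also have "\<dots> > 0"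
    using assms by (intro add_nonneg_pos) auto
  finally show ?thesis
    using assms by (simp add: bound_const_def zero_less_mult_iff)
qed

lemma L2_set_dist_orth_proj:
  fixes e :: "'n::finite \<Rightarrow> real ^ 'n"
  assumes e: "orthonormal_system e" and L: "subspace L"
  shows "L2_set (\<lambda>i. dist (l *\<^sub>R e i) (orth_proj L (e i))) UNIV = bound_const CARD('n) (dim L) l"
proof -
  have "(\<Sum>i\<in>UNIV. (dist (l *\<^sub>R e i) (orth_proj L (e i)))\<^sup>2)
      = (\<Sum>i\<in>UNIV. l\<^sup>2 + (1 - 2 * l) * (norm (orth_proj L (e i)))\<^sup>2)"
    using e by (simp add: dist_scaleR_orth_proj_sq'[OF L] orthonormal_system_def)
  also have "\<dots> = real CARD('n) * l\<^sup>2 + (1 - 2 * l) * real (dim L)"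
    by (simp add: sum.distrib sum_norm_orth_proj[OF e L] flip: sum_distrib_left)
  finally show ?thesis
    by (simp add: L2_set_def bound_const_def algebra_simps)
qed

lemma sum_BH_scaled:
  fixes e :: "'n::finite \<Rightarrow> real ^ 'n"
  assumes L: "subspace L" and a: "\<And>i. 0 \<le> a i"
  shows "sum_BH l (\<lambda>i. a i *\<^sub>R e i) L = (\<Sum>i\<in>UNIV. a i * dist (l *\<^sub>R e i) (orth_proj L (e i)))"
proof -
  have "dist (l *\<^sub>R a i *\<^sub>R e i) (orth_proj L (a i *\<^sub>R e i))
      = a i * dist (l *\<^sub>R e i) (orth_proj L (e i))" for i
  proof -
    have "l *\<^sub>R a i *\<^sub>R e i - orth_proj L (a i *\<^sub>R e i)
        = a i *\<^sub>R (l *\<^sub>R e i - orth_proj L (e i))"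
      by (simp add: orth_proj_scaleR[OF L] algebra_simps)
    then show ?thesis
      using a[of i] by (simp add: dist_norm del: scaleR_scaleR)
  qed
  then show ?thesis
    by (simp add: sum_BH_def)
qed

lemma norm_opposite_vertex_scaled:
  fixes e :: "'n::finite \<Rightarrow> real ^ 'n"
  assumes "orthonormal_system e"
  shows "norm (opposite_vertex (\<lambda>i. a i *\<^sub>R e i)) = L2_set a UNIV"
proof -
  have "(norm (\<Sum>i\<in>UNIV. a i *\<^sub>R e i))\<^sup>2 = (\<Sum>i\<in>UNIV. (norm (a i *\<^sub>R e i))\<^sup>2)"
    using assms by (intro norm_sum_Pythagorean)
      (auto simp: pairwise_def orthonormal_system_def orthogonal_def)
  also have "\<dots> = (\<Sum>i\<in>UNIV. (a i)\<^sup>2)"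
    using assms by (simp add: orthonormal_system_def)
  finally show ?thesis
    by (simp add: opposite_vertex_def L2_set_def real_sqrt_unique)
qed

section \<open>The inequality\<close>

lemma right_simplex_edges:
  fixes A :: "'n::finite \<Rightarrow> real ^ 'n"
  assumes "right_simplex_at_0 A"
  obtains e a where "orthonormal_system e" and "\<And>i. 0 < a i" and "A = (\<lambda>i. a i *\<^sub>R e i)"
proof
  have nz: "A i \<noteq> 0" for i
    using assms unfolding right_simplex_at_0_def simplex_at_0_def by (metis rangeI)
  show "orthonormal_system (\<lambda>i. inverse (norm (A i)) *\<^sub>R A i)"
    using assms nz by (auto simp: orthonormal_system_def right_simplex_at_0_def orthogonal_def)
  show "0 < norm (A i)" for i
    using nz by simp
  show "A = (\<lambda>i. norm (A i) *\<^sub>R inverse (norm (A i)) *\<^sub>R A i)"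
    using nz by simp
qed

lemma bound_holds_bound_const: "bound_holds TYPE('n::finite) k l (bound_const CARD('n) k l)"
  unfolding bound_holds_def
proof (intro allI impI, elim conjE)
  fix A :: "'n \<Rightarrow> real ^ 'n" and L :: "(real ^ 'n) set"
  assume A: "right_simplex_at_0 A" and L: "subspace L" "dim L = k"
  obtain e a where e: "orthonormal_system e" and a: "\<And>i. 0 < a i" and A_eq: "A = (\<lambda>i. a i *\<^sub>R e i)"
    using right_simplex_edges[OF A] by blast
  let ?d = "\<lambda>i. dist (l *\<^sub>R e i) (orth_proj L (e i))"
  have "sum_BH l A L = (\<Sum>i\<in>UNIV. \<bar>a i\<bar> * \<bar>?d i\<bar>)"
    using a by (simp add: A_eq sum_BH_scaled[OF L(1)] less_imp_le)
  also have "\<dots> \<le> L2_set a UNIV * L2_set ?d UNIV"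
    by (rule L2_set_mult_ineq)
  also have "\<dots> = bound_const CARD('n) k l * dist 0 (opposite_vertex A)"
    by (simp add: A_eq norm_opposite_vertex_scaled[OF e] L2_set_dist_orth_proj[OF e L(1)] L(2))
  finally show "sum_BH l A L \<le> bound_const CARD('n) k l * dist 0 (opposite_vertex A)" .
qed

text \<open>With edge lengths \<open>a i = d i + t\<close> the left-hand side is at least \<open>b\<^sup>2\<close>, where \<open>b\<close> is the length of
  \<open>d\<close>, while the length of the diagonal tends to \<open>b\<close> as \<open>t\<close> tends to \<open>0\<close>. So \<open>b\<^sup>2 \<le> c * b\<close>.\<close>

lemma bound_const_le:
  assumes k: "0 < k" "k < CARD('n::finite)" and c: "bound_holds TYPE('n) k l c"
  shows "bound_const CARD('n) k l \<le> c"
proof -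
  let ?b = "bound_const CARD('n) k l"
  have "k \<le> dim (UNIV :: (real ^ 'n) set)"
    using k by simp
  then obtain L :: "(real ^ 'n) set" where L: "subspace L" "dim L = k"
    using choose_subspace_of_subspace by metis
  define e :: "'n \<Rightarrow> real ^ 'n" where "e i = axis i 1" for i
  have e: "orthonormal_system e"
    by (auto simp: orthonormal_system_def e_def orthogonal_def inner_axis_axis)
  define d where "d i = dist (l *\<^sub>R e i) (orth_proj L (e i))" for i
  have d0: "0 \<le> d i" for i
    by (simp add: d_def)
  have b: "L2_set d UNIV = ?b"
    using L2_set_dist_orth_proj[OF e L(1), of l] L(2) by (simp add: d_def[abs_def])
  have b0: "0 < ?b"
    using k by (rule bound_const_pos)
  have sq: "(\<Sum>i\<in>UNIV. d i * d i) = ?b * ?b"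
    unfolding b[symmetric] by (simp add: L2_set_def sum_nonneg flip: power2_eq_square)
  have main: "?b * ?b \<le> c * L2_set (\<lambda>i. d i + t) UNIV" if t: "0 < t" for t
  proof -
    have pos: "0 < d i + t" for i
      using d0[of i] t by simp
    have "?b * ?b \<le> (\<Sum>i\<in>UNIV. (d i + t) * d i)"
      unfolding sq[symmetric] using t d0 by (intro sum_mono mult_right_mono) auto
    also have "\<dots> = sum_BH l (\<lambda>i. (d i + t) *\<^sub>R e i) L"
      using pos by (simp add: sum_BH_scaled[OF L(1)] less_imp_le flip: d_def)
    also have "\<dots> \<le> c * dist 0 (opposite_vertex (\<lambda>i. (d i + t) *\<^sub>R e i))"
      using c[unfolded bound_holds_def, rule_format,
          OF conjI[OF right_simplex_scaled[OF e pos] conjI[OF L]]] .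
    finally show ?thesis
      by (simp only: dist_0_norm norm_opposite_vertex_scaled[OF e])
  qed
  have "((\<lambda>t. c * L2_set (\<lambda>i. d i + t) UNIV) \<longlongrightarrow> c * L2_set (\<lambda>i. d i + 0) UNIV) (at_right 0)"
    unfolding L2_set_def by (intro tendsto_intros)
  moreover have "\<forall>\<^sub>F t in at_right 0. ?b * ?b \<le> c * L2_set (\<lambda>i. d i + t) UNIV"
    using main by (auto simp: eventually_at_right_field intro: exI[of _ 1])
  ultimately have "?b * ?b \<le> c * L2_set (\<lambda>i. d i + 0) UNIV"
    by (rule tendsto_lowerbound) simp
  then show ?thesis
    using b b0 by simp
qed

section \<open>The case of equality\<close>

text \<open>With \<open>d i = \<bar>l *\<^sub>R e i - P (e i)\<bar>\<close>, the choice \<open>a = d\<close> gives equality. Conversely, if \<open>b\<close> and \<open>s\<close>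
  are the lengths of \<open>d\<close> and \<open>a\<close>, then
  \<open>(\<Sum>i. (b * a i - s * d i)\<^sup>2) = 2 * b * s * (b * s - (\<Sum>i. a i * d i))\<close>. So equality forces
  \<open>b * a i = s * d i\<close> for all \<open>i\<close>, and \<open>d i\<close> cannot vanish because \<open>b\<close> and \<open>a i\<close> are positive.\<close>

lemma equality_attainable_iff:
  fixes e :: "'n::finite \<Rightarrow> real ^ 'n"
  assumes k: "0 < k" "k < CARD('n)"
    and e: "orthonormal_system e" and L: "subspace L" "dim L = k"
  shows "equality_attainable k l e L \<longleftrightarrow> (\<forall>i. l *\<^sub>R e i \<noteq> orth_proj L (e i))"
proof -
  let ?b = "bound_const CARD('n) k l"
  define d where "d i = dist (l *\<^sub>R e i) (orth_proj L (e i))" for i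
  have b: "L2_set d UNIV = ?b"
    using L2_set_dist_orth_proj[OF e L(1), of l] L(2) by (simp add: d_def[abs_def])
  have b0: "0 < ?b"
    using k by (rule bound_const_pos)
  have sq: "(\<Sum>i\<in>UNIV. (d i)\<^sup>2) = ?b\<^sup>2"
    unfolding b[symmetric] by (simp add: L2_set_def sum_nonneg)
  have BH: "sum_BH l (\<lambda>i. a i *\<^sub>R e i) L = (\<Sum>i\<in>UNIV. a i * d i)" if "\<And>i. 0 < a i" for a
    using that by (simp add: sum_BH_scaled[OF L(1)] less_imp_le d_def)
  have "equality_attainable k l e L \<longleftrightarrow> (\<forall>i. 0 < d i)"
  proof
    assume pos: "\<forall>i. 0 < d i"
    then have "sum_BH l (\<lambda>i. d i *\<^sub>R e i) L = ?b * ?b"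
      using BH[of d] sq by (simp only: power2_eq_square)
    also have "\<dots> = ?b * dist 0 (opposite_vertex (\<lambda>i. d i *\<^sub>R e i))"
      by (simp only: dist_0_norm norm_opposite_vertex_scaled[OF e] b)
    finally show "equality_attainable k l e L"
      unfolding equality_attainable_def using pos by blast
  next
    assume "equality_attainable k l e L"
    then obtain a where a: "\<And>i. 0 < a i"
      and "sum_BH l (\<lambda>i. a i *\<^sub>R e i) L = ?b * dist 0 (opposite_vertex (\<lambda>i. a i *\<^sub>R e i))"
      unfolding equality_attainable_def by blast
    define s where "s = L2_set a UNIV"
    have eq: "(\<Sum>i\<in>UNIV. a i * d i) = ?b * s"
      using \<open>sum_BH l _ L = _\<close> by (simp add: BH a norm_opposite_vertex_scaled[OF e] s_def)
    have s: "(\<Sum>i\<in>UNIV. (a i)\<^sup>2) = s\<^sup>2"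
      by (simp add: s_def L2_set_def sum_nonneg)
    have "(\<Sum>i\<in>UNIV. (?b * a i - s * d i)\<^sup>2)
        = (\<Sum>i\<in>UNIV. ?b\<^sup>2 * (a i)\<^sup>2 + s\<^sup>2 * (d i)\<^sup>2 - 2 * ?b * s * (a i * d i))"
      by (intro sum.cong) (auto simp: power2_eq_square algebra_simps)
    also have "\<dots> = ?b\<^sup>2 * s\<^sup>2 + s\<^sup>2 * ?b\<^sup>2 - 2 * ?b * s * (?b * s)"
      by (simp only: sum.distrib sum_subtractf s sq eq flip: sum_distrib_left)
    also have "\<dots> = 0"
      by (simp add: power2_eq_square)
    finally have "\<forall>i\<in>UNIV. (?b * a i - s * d i)\<^sup>2 = 0"
      by (subst (asm) sum_nonneg_eq_0_iff) auto
    then have "?b * a i = s * d i" for i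
      by simp
    then have "d i \<noteq> 0" for i
      using b0 a by (metis less_irrefl mult_pos_pos mult_zero_right)
    then show "\<forall>i. 0 < d i"
      by (simp add: d_def)
  qed
  then show ?thesis
    by (simp add: d_def)
qed

lemma scaleR_eq_orth_proj_iff:
  fixes L :: "('a::euclidean_space) set"
  assumes "subspace L"
  shows "l *\<^sub>R x = orth_proj L x \<longleftrightarrow>
    (l = 1 \<or> (\<forall>y\<in>L. orthogonal x y)) \<and> (l = 0 \<or> x \<in> L)"
proof -
  have "l *\<^sub>R x = orth_proj L x \<longleftrightarrow> (dist (l *\<^sub>R x) (orth_proj L x))\<^sup>2 = 0"
    by simp
  also have "\<dots> \<longleftrightarrow> (l = 1 \<or> orth_proj L x = 0) \<and> (l = 0 \<or> orth_proj L x = x)"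
    by (auto simp add: dist_scaleR_orth_proj_sq[OF assms] sum_power2_eq_zero_iff)
  finally show ?thesis
    by (simp add: orth_proj_eq_0_iff[OF assms] orth_proj_eq_self_iff[OF assms])
qed

theorem corollary3p2:
  fixes k :: nat and l :: real
  assumes "1 \<le> k" and "k \<le> CARD('n::finite) - 1"
  shows "bound_holds TYPE('n) k l (bound_const CARD('n) k l)
    \<and> \<not> (\<exists>c < bound_const CARD('n) k l. bound_holds TYPE('n) k l c)
    \<and> (\<forall>(e :: 'n \<Rightarrow> real ^ 'n) (L :: (real ^ 'n) set).
         orthonormal_system e \<and> subspace L \<and> dim L = k \<longrightarrow>
           (l \<noteq> 0 \<and> l \<noteq> 1 \<longrightarrow> equality_attainable k l e L)
         \<and> (l = 0 \<longrightarrow>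
              (equality_attainable k l e L \<longleftrightarrow> \<not> (\<exists>i. \<forall>y\<in>L. orthogonal (e i) y)))
         \<and> (l = 1 \<longrightarrow>
              (equality_attainable k l e L \<longleftrightarrow> \<not> (\<exists>i. e i \<in> L))))"
proof (intro conjI)
  have k: "0 < k" "k < CARD('n)"
    using assms by auto
  show "bound_holds TYPE('n) k l (bound_const CARD('n) k l)"
    by (rule bound_holds_bound_const)
  show "\<not> (\<exists>c < bound_const CARD('n) k l. bound_holds TYPE('n) k l c)"
    using bound_const_le[OF k] by (meson not_le)
  show "\<forall>(e :: 'n \<Rightarrow> real ^ 'n) (L :: (real ^ 'n) set).
         orthonormal_system e \<and> subspace L \<and> dim L = k \<longrightarrow>
           (l \<noteq> 0 \<and> l \<noteq> 1 \<longrightarrow> equality_attainable k l e L)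
         \<and> (l = 0 \<longrightarrow>
              (equality_attainable k l e L \<longleftrightarrow> \<not> (\<exists>i. \<forall>y\<in>L. orthogonal (e i) y)))
         \<and> (l = 1 \<longrightarrow>
              (equality_attainable k l e L \<longleftrightarrow> \<not> (\<exists>i. e i \<in> L)))"
  proof (intro allI impI, elim conjE)
    fix e :: "'n \<Rightarrow> real ^ 'n" and L :: "(real ^ 'n) set"
    assume e: "orthonormal_system e" and L: "subspace L" "dim L = k"
    have "e i \<noteq> 0" for i
      using e by (metis norm_zero orthonormal_system_def zero_neq_one)
    then have "\<not> (e i \<in> L \<and> (\<forall>y\<in>L. orthogonal (e i) y))" for i
      using orthogonal_self by blast
    then show "(l \<noteq> 0 \<and> l \<noteq> 1 \<longrightarrow> equality_attainable k l e L)
         \<and> (l = 0 \<longrightarrow>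
              (equality_attainable k l e L \<longleftrightarrow> \<not> (\<exists>i. \<forall>y\<in>L. orthogonal (e i) y)))
         \<and> (l = 1 \<longrightarrow>
              (equality_attainable k l e L \<longleftrightarrow> \<not> (\<exists>i. e i \<in> L)))"
      unfolding equality_attainable_iff[OF k e L] scaleR_eq_orth_proj_iff[OF L(1)] by auto
  qed
qed

end
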